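(* Let $I\subset\mathbb{N}$ be a finite index set, let $X_i$ ($i\in I$) be real random variables, all continuous with probability density functions $f_{X_i}$ or all discrete with probability mass functions $f_{X_i}$, and let $A_i\in\mathbb{R}$ ($i\in I$) with $\sum_{i\in I}A_i=1$. Let $Y$ be a random variable (of the same type) whose density (respectively mass function) is $$f_Y(t)=\sum_{i\in I}A_i f_{X_i}(t).$$ Then the cumulative distribution function of $Y$ is, for all $t\in\mathbb{R}$, $$F_Y(t)=\sum_{i\in I}A_iF_{X_i}(t),$$ where $F_{X_i}$ is the cumulative distribution function of $X_i$.
   Context: A distribution $Y$ is called a (New) Mixed Distribution of $(X_i)_{i\in I}$ if its PDF has the form $f_Y=\sum_{i\in I}A_if_{X_i}$ with real coefficients $A_i$ (possibly negative) such that $\sum_{i\in I}A_i=1$. "PDF" means probability density function in the continuous case and probability mass function in the discrete case. *)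

theory Defs
  imports "HOL-Probability.Probability"
begin

(* The coercion ennreal truncates negative values to 0, so the nonnegativity of the
   real-valued density has to be demanded separately; almost everywhere is enough, since
   a density may be changed on a null set. *)
definition has_pdf :: "'a measure \<Rightarrow> ('a \<Rightarrow> real) \<Rightarrow> (real \<Rightarrow> real) \<Rightarrow> bool" where
  "has_pdf M X f \<longleftrightarrow>
     f \<in> borel_measurable borel \<and>
     (AE x in lborel. 0 \<le> f x) \<and>
     distributed M lborel X (\<lambda>x. ennreal (f x))"

(* distributed M (count_space UNIV) would require every preimage of a set of reals
   to be measurable, and simple_distributed only covers finitely many values; so discreteness
   is expressed by almost sure membership in a countable set. *)
definition has_pmf :: "'a measure \<Rightarrow> ('a \<Rightarrow> real) \<Rightarrow> (real \<Rightarrow> real) \<Rightarrow> bool" where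
  "has_pmf M X f \<longleftrightarrow>
     X \<in> borel_measurable M \<and>
     (\<exists>S. countable S \<and> (AE \<omega> in M. X \<omega> \<in> S)) \<and>
     (\<forall>x. f x = measure M {\<omega> \<in> space M. X \<omega> = x})"

end

theory Submission
  imports Defs
begin

text \<open>
  In both cases the distribution function at \<open>t\<close> is the Bochner integral of \<open>f\<close> over \<open>{..t}\<close>,
  with respect to Lebesgue measure for densities and to counting measure on the reals for mass
  functions. Integrating against one common measure makes the claim an instance of linearity,
  whatever the signs of the coefficients.
\<close>

text \<open>The nonnegative integral of the density over \<open>{..t}\<close> is the probability of
  the preimage of \<open>{..t}\<close>. As this value is finite and \<open>f\<close> is nonnegative
  almost everywhere, the Bochner integral exists and has the same value.\<close>

lemma has_pdf_cdf_integral: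
  assumes "prob_space M" "has_pdf M X f"
  shows "has_bochner_integral lborel (\<lambda>x. indicator {..t} x * f x) (cdf (distr M borel X) t)"
proof -
  interpret prob_space M by fact
  have meas [measurable]: "f \<in> borel_measurable borel"
    and nonneg: "AE x in lborel. 0 \<le> f x"
    and dist: "distributed M lborel X (\<lambda>x. ennreal (f x))"
    using assms(2) by (auto simp: has_pdf_def)
  have X [measurable]: "X \<in> borel_measurable M"
    using distributed_measurable[OF dist] by simp
  have "(\<integral>\<^sup>+x. ennreal (indicator {..t} x * f x) \<partial>lborel) =
        (\<integral>\<^sup>+x. ennreal (f x) * indicator {..t} x \<partial>lborel)"
    by (intro nn_integral_cong) (auto split: split_indicator)
  also have "\<dots> = emeasure M (X -` {..t} \<inter> space M)"
    using distributed_emeasure[OF dist, of "{..t}"] by simp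
  also have "\<dots> = ennreal (cdf (distr M borel X) t)"
    by (simp add: cdf_def measure_distr emeasure_eq_measure)
  finally show ?thesis
    using nonneg by (intro has_bochner_integral_nn_integral) (auto simp: cdf_def)
qed

text \<open>The law of \<open>X\<close> lives on a countable set \<open>S\<close>, so the mass of
  \<open>{..t}\<close> is the sum of the point masses in \<open>S \<inter> {..t}\<close>. Points
  outside \<open>S\<close> have mass zero; hence the sum can run over all reals, which gives one
  measure common to variables with different sets \<open>S\<close>.\<close>

lemma has_pmf_cdf_integral:
  assumes "prob_space M" "has_pmf M X f"
  shows "has_bochner_integral (count_space UNIV) (\<lambda>x. indicator {..t} x * f x)
           (cdf (distr M borel X) t)"
proof -
  interpret prob_space M by fact
  obtain S where S: "countable S" "AE \<omega> in M. X \<omega> \<in> S"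
    and X [measurable]: "X \<in> borel_measurable M"
    and f: "\<And>x. f x = measure M {\<omega> \<in> space M. X \<omega> = x}"
    using assms(2) by (auto simp: has_pmf_def)
  define D where "D = distr M borel X"
  interpret D: prob_space D
    unfolding D_def by (rule prob_space_distr) measurable
  have sets_D [simp]: "sets D = sets borel"
    by (simp add: D_def)
  \<comment> \<open>\<open>S\<close> is only known to be countable, but countable sets of reals are
    Borel.\<close>
  have S_borel: "S \<inter> B \<in> sets borel" for B
    by (rule sets.countable) (use S(1) in auto)
  have f_D: "ennreal (f x) = emeasure D {x}" for x
    by (simp add: f D_def emeasure_distr emeasure_eq_measure vimage_def Int_def conj_commute)
  have AE_D: "AE x in D. x \<in> S"
    unfolding D_def using S(2) S_borel[of UNIV] by (subst AE_distr_iff[OF X]) auto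
  have f_outside: "ennreal (f x) = 0" if "x \<notin> S" for x
  proof -
    \<comment> \<open>Almost every point lies in \<open>S\<close> and \<open>x\<close> does not, so
      \<open>{x}\<close> agrees with the empty set up to a null set.\<close>
    have "emeasure D {x} = emeasure D {}"
      using AE_D that by (intro emeasure_eq_AE) auto
    then show ?thesis by (simp add: f_D)
  qed
  have "(\<integral>\<^sup>+x. ennreal (indicator {..t} x * f x) \<partial>count_space UNIV) =
        (\<integral>\<^sup>+x. emeasure D {x} * indicator (S \<inter> {..t}) x \<partial>count_space UNIV)"
    by (intro nn_integral_cong) (auto simp: f_D[symmetric] f_outside split: split_indicator)
  also have "\<dots> = (\<integral>\<^sup>+x. emeasure D {x} \<partial>count_space (S \<inter> {..t}))"
    by (simp add: nn_integral_count_space_indicator)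
  also have "\<dots> = emeasure D (S \<inter> {..t})"
    \<comment> \<open>Countable additivity over singletons.\<close>
    using S(1) by (intro emeasure_countable_singleton[symmetric]) auto
  also have "\<dots> = emeasure D {..t}"
    using AE_D S_borel by (intro emeasure_eq_AE) auto
  also have "\<dots> = ennreal (cdf D t)"
    by (simp add: cdf_def D.emeasure_eq_measure)
  finally show ?thesis
    unfolding D_def by (intro has_bochner_integral_nn_integral) (auto simp: cdf_def f)
qed

text \<open>Linearity gives a second value for the integral in the last assumption, and Bochner
  integrals are unique.\<close>

lemma has_bochner_integral_mixture_eq:
  fixes f :: "'i \<Rightarrow> 'a \<Rightarrow> real"
  assumes "\<And>i. i \<in> I \<Longrightarrow> has_bochner_integral L (\<lambda>x. indicator B x * f i x) (c i)"
    and "has_bochner_integral L (\<lambda>x. indicator B x * (\<Sum>i\<in>I. A i * f i x)) d"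
  shows "d = (\<Sum>i\<in>I. A i * c i)"
proof -
  have "has_bochner_integral L (\<lambda>x. \<Sum>i\<in>I. A i * (indicator B x * f i x)) (\<Sum>i\<in>I. A i * c i)"
    using assms(1) by (intro has_bochner_integral_sum has_bochner_integral_mult_right) auto
  then have "has_bochner_integral L (\<lambda>x. indicator B x * (\<Sum>i\<in>I. A i * f i x)) (\<Sum>i\<in>I. A i * c i)"
    by (simp add: sum_distrib_left mult_ac)
  with assms(2) show ?thesis by (rule has_bochner_integral_eq)
qed

theorem theorem2:
  fixes I :: "nat set"
    and M :: "nat \<Rightarrow> 'a measure" and X :: "nat \<Rightarrow> 'a \<Rightarrow> real"
    and f :: "nat \<Rightarrow> real \<Rightarrow> real" and A :: "nat \<Rightarrow> real"
    and N :: "'b measure" and Y :: "'b \<Rightarrow> real"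
  assumes "finite I"
    and "\<And>i. i \<in> I \<Longrightarrow> prob_space (M i)"
    and "prob_space N"
    and "(\<Sum>i\<in>I. A i) = 1"
    and "((\<forall>i\<in>I. has_pdf (M i) (X i) (f i)) \<and> has_pdf N Y (\<lambda>t. \<Sum>i\<in>I. A i * f i t)) \<or>
         ((\<forall>i\<in>I. has_pmf (M i) (X i) (f i)) \<and> has_pmf N Y (\<lambda>t. \<Sum>i\<in>I. A i * f i t))"
  shows "\<forall>t. cdf (distr N borel Y) t = (\<Sum>i\<in>I. A i * cdf (distr (M i) borel (X i)) t)"
proof (rule allI)
  fix t
  from assms(5) show "cdf (distr N borel Y) t = (\<Sum>i\<in>I. A i * cdf (distr (M i) borel (X i)) t)"
  proof (elim disjE conjE)
    assume "\<forall>i\<in>I. has_pdf (M i) (X i) (f i)" "has_pdf N Y (\<lambda>t. \<Sum>i\<in>I. A i * f i t)"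
    then show ?thesis
      using assms(2,3)
      \<comment> \<open>The integral for \<open>Y\<close> comes from the same lemma as those for the
        \<open>X i\<close>, with the mixture as density.\<close>
      by (intro has_bochner_integral_mixture_eq[of I lborel "{..t}" f]) (auto intro: has_pdf_cdf_integral)
  next
    assume "\<forall>i\<in>I. has_pmf (M i) (X i) (f i)" "has_pmf N Y (\<lambda>t. \<Sum>i\<in>I. A i * f i t)"
    then show ?thesis
      using assms(2,3)
      by (intro has_bochner_integral_mixture_eq[of I "count_space UNIV" "{..t}" f])
        (auto intro: has_pmf_cdf_integral)
  qed
qed

end
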